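(* Let $n\ge1$, $d\ge2$, $A_i,B_i\in\mathbb C^{n\times n}$ and $f_i:\mathbb C\to\mathbb C$ for $i=1,\dots,d$, and let $$P(\mu)=\sum_{i=1}^d (A_i-\mu B_i)f_i(\mu),\qquad f(\mu)=[f_1(\mu)\ \cdots\ f_d(\mu)]^{T}.$$ Let $M,N\in\mathbb C^{(d-1)\times d}$ satisfy $(M-\mu N)f(\mu)=0$ and $\operatorname{rank}(M-\mu N)=d-1$, with $f(\mu)\ne0$. Define $$\mathbf A=\begin{bmatrix}A_1\ A_2\ \cdots\ A_d\\ M\otimes I_n\end{bmatrix},\qquad \mathbf B=\begin{bmatrix}B_1\ B_2\ \cdots\ B_d\\ N\otimes I_n\end{bmatrix}\in\mathbb C^{dn\times dn}.$$ Let $b\in\mathbb C^n$ and $\mathbf d=e_1\otimes b=[b^{T}\ 0]^{T}\in\mathbb C^{dn}$. Then $x\in\mathbb C^n$ is the unique solution to $P(\mu)x=b$ if and only if $\mathbf y=f(\mu)\otimes x\in\mathbb C^{dn}$ is the unique solution to $(\mathbf A-\mu\mathbf B)\mathbf y=\mathbf d$.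
   Context: $\otimes$ is the Kronecker product, $I_n$ the $n\times n$ identity matrix, and $e_1\in\mathbb C^d$ the first standard unit vector. The parameter $\mu\in\mathbb C$ is fixed (any value at which the functions $f_i$ are defined and the stated conditions hold). *)

theory Defs
  imports Complex_Main "Jordan_Normal_Form.DL_Rank"
begin

text \<open>
  Matrices and vectors are 0-indexed, as in Jordan_Normal_Form. The families
  \<open>A\<^sub>i, B\<^sub>i, f\<^sub>i\<close>, for \<open>i = 1, \<dots>, d\<close>, are functions on \<open>nat\<close> of which only the
  values on \<open>{1..d}\<close> are used.
\<close>

definition kron_mat :: "'a :: times mat \<Rightarrow> 'a mat \<Rightarrow> 'a mat" where
  "kron_mat A B = mat (dim_row A * dim_row B) (dim_col A * dim_col B)
     (\<lambda>(i, j). A $$ (i div dim_row B, j div dim_col B) * B $$ (i mod dim_row B, j mod dim_col B))"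

definition kron_vec :: "'a :: times vec \<Rightarrow> 'a vec \<Rightarrow> 'a vec" where
  "kron_vec u v = vec (dim_vec u * dim_vec v)
     (\<lambda>i. u $ (i div dim_vec v) * v $ (i mod dim_vec v))"

text \<open>The block row \<open>[A\<^sub>1 A\<^sub>2 \<dots> A\<^sub>d]\<close> of \<open>n \<times> n\<close> blocks.\<close>

definition block_row :: "nat \<Rightarrow> nat \<Rightarrow> (nat \<Rightarrow> 'a mat) \<Rightarrow> 'a mat" where
  "block_row n d A = mat n (d * n) (\<lambda>(i, j). A (Suc (j div n)) $$ (i, j mod n))"

text \<open>\<open>P(\<mu>) = \<Sum>\<^sub>i (A\<^sub>i - \<mu> B\<^sub>i) f\<^sub>i(\<mu>)\<close>; the type of matrices is not additive, so the sum is
  taken entry by entry.\<close>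

definition nonlinear_mat ::
  "nat \<Rightarrow> nat \<Rightarrow> (nat \<Rightarrow> complex mat) \<Rightarrow> (nat \<Rightarrow> complex mat) \<Rightarrow> (nat \<Rightarrow> complex \<Rightarrow> complex)
    \<Rightarrow> complex \<Rightarrow> complex mat" where
  "nonlinear_mat n d A B f \<mu> =
     mat n n (\<lambda>(r, c). \<Sum>i = 1..d. (f i \<mu> \<cdot>\<^sub>m (A i - \<mu> \<cdot>\<^sub>m B i)) $$ (r, c))"

definition fun_vec :: "nat \<Rightarrow> (nat \<Rightarrow> complex \<Rightarrow> complex) \<Rightarrow> complex \<Rightarrow> complex vec" where
  "fun_vec d f \<mu> = vec d (\<lambda>i. f (Suc i) \<mu>)"

text \<open>With \<open>C = A\<close>, \<open>K = M\<close> this is \<open>\<bold>A\<close>, and with \<open>C = B\<close>, \<open>K = N\<close> it is \<open>\<bold>B\<close>.\<close>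

definition linearization ::
  "nat \<Rightarrow> nat \<Rightarrow> (nat \<Rightarrow> complex mat) \<Rightarrow> complex mat \<Rightarrow> complex mat" where
  "linearization n d C K = block_row n d C @\<^sub>r kron_mat K (1\<^sub>m n)"

definition is_unique_solution :: "'a :: semiring_0 mat \<Rightarrow> 'a vec \<Rightarrow> 'a vec \<Rightarrow> bool" where
  "is_unique_solution A b x \<longleftrightarrow>
     x \<in> carrier_vec (dim_col A) \<and> A *\<^sub>v x = b \<and>
     (\<forall>z \<in> carrier_vec (dim_col A). A *\<^sub>v z = b \<longrightarrow> z = x)"

end

theory Submission
  imports Defs
begin

text \<open>
  Write \<open>K = M - \<mu> N\<close>, \<open>g = f(\<mu>)\<close> and \<open>C\<^sub>i = A\<^sub>i - \<mu> B\<^sub>i\<close>. The pencil \<open>\<bold>A - \<mu> \<bold>B\<close> is the block row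
  \<open>[C\<^sub>1 \<dots> C\<^sub>d]\<close> on top of \<open>K \<otimes> I\<close>, and \<open>\<bold>d\<close> is \<open>b\<close> on top of zeros, so the linear system for
  \<open>\<bold>y\<close> splits into \<open>[C\<^sub>1 \<dots> C\<^sub>d] \<bold>y = b\<close> and \<open>(K \<otimes> I) \<bold>y = 0\<close>.

  Since \<open>K\<close> has \<open>d\<close> columns and rank \<open>d - 1\<close>, its kernel is the line through the nonzero vector
  \<open>g\<close> (\<open>kernel_full_row_rank\<close>). The matrix \<open>K \<otimes> I\<close> applies \<open>K\<close> separately to each of the \<open>n\<close>
  vectors that collect the entries of \<open>\<bold>y\<close> at one fixed position inside the blocks. Hence
  \<open>(K \<otimes> I) \<bold>y = 0\<close> says that each of them is a multiple of \<open>g\<close>, that is, that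
  \<open>\<bold>y = g \<otimes> z\<close> for some \<open>z\<close> (\<open>kron_one_kernel_iff\<close>). On such vectors the block row acts as
  \<open>\<Sum>\<^sub>i g\<^sub>i C\<^sub>i z = P(\<mu>) z\<close> (\<open>nonlinear_mat_mult_vec\<close>).

  So \<open>z \<mapsto> g \<otimes> z\<close> maps the solutions of \<open>P(\<mu>) z = b\<close> onto the solutions of the linear system
  (\<open>linearization_solution_iff\<close>), and it is injective because \<open>g \<noteq> 0\<close>
  (\<open>kron_vec_right_cancel\<close>). A bijection between solution sets preserves uniqueness.
\<close>

section \<open>Kernels of matrices with full row rank and one more column than rows\<close>

text \<open>
  The rank is the size of a maximal independent set of columns. If that size is the number of
  rows, the set is a basis of the whole space, so the columns span it.
\<close>

lemma full_row_rank_surjective: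
  fixes K :: "'a :: field mat"
  assumes K: "K \<in> carrier_mat m nc" and rank: "vec_space.rank m K = m"
    and u: "u \<in> carrier_vec m"
  obtains v where "v \<in> carrier_vec nc" "K *\<^sub>v v = u"
proof -
  interpret vec_space "TYPE('a)" m .
  have cols: "set (cols K) \<subseteq> carrier_vec m"
    using K cols_dim by blast
  obtain S where S: "maximal S (\<lambda>T. T \<subseteq> set (cols K) \<and> lin_indpt T)"
    using maximal_exists_superset[of "set (cols K)" "\<lambda>T. T \<subseteq> set (cols K) \<and> lin_indpt T" "{}"]
      lin_dep_crit finite_lin_indpt2[of "{}"] by auto
  then have sub: "S \<subseteq> set (cols K)" and li: "lin_indpt S"
    by (auto simp: maximal_def)
  have "card S = m"
    using rank_card_indpt[OF K S] rank by simp
  then have "basis S"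
    using sub cols li by (intro dim_li_is_basis) (auto simp: dim_is_n intro: finite_subset)
  then have "carrier_vec m \<subseteq> span (set (cols K))"
    using span_is_monotone[OF sub] by (auto simp: basis_def)
  then have "u \<in> col_space K"
    using u by (auto simp: col_space_def)
  then show thesis
    using that K by (auto simp: col_space_eq[OF K])
qed

text \<open>
  Preimages of the unit vectors, taken as columns, form a right inverse; for a square matrix over
  a field a right inverse is also a left inverse.
\<close>

lemma surjective_square_mat_injective:
  fixes S :: "'a :: field mat"
  assumes S: "S \<in> carrier_mat m m"
    and surj: "\<And>u. u \<in> carrier_vec m \<Longrightarrow> \<exists>v \<in> carrier_vec m. S *\<^sub>v v = u"
    and w: "w \<in> carrier_vec m" and Sw: "S *\<^sub>v w = 0\<^sub>v m"
  shows "w = 0\<^sub>v m"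
proof -
  have "\<exists>v. v \<in> carrier_vec m \<and> S *\<^sub>v v = unit_vec m j" for j
    using surj[of "unit_vec m j"] by auto
  then obtain V where V: "\<And>j. V j \<in> carrier_vec m" "\<And>j. S *\<^sub>v V j = unit_vec m j"
    by metis
  define R where "R = mat_of_cols m (map V [0..<m])"
  have R: "R \<in> carrier_mat m m"
    unfolding R_def by (auto simp: mat_of_cols_def)
  have "S * R = 1\<^sub>m m"
  proof (rule mat_col_eqI)
    fix j assume "j < dim_col (1\<^sub>m m :: 'a mat)"
    then have j: "j < m" by simp
    have "col R j = V j"
      unfolding R_def using j V by simp
    then show "col (S * R) j = col (1\<^sub>m m) j"
      using col_mult2[OF S R j] V j by simp
  qed (use S R in auto)
  then have "R * S = 1\<^sub>m m"
    by (rule mat_mult_left_right_inverse[OF S R])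
  then have "w = R *\<^sub>v (S *\<^sub>v w)"
    using assoc_mult_mat_vec[OF R S w] w by simp
  also have "\<dots> = 0\<^sub>v m"
    unfolding Sw using R by (auto simp: scalar_prod_def)
  finally show ?thesis .
qed

text \<open>
  Extend \<open>K\<close> by the row that reads off entry \<open>k\<close>, where \<open>g\<close> does not vanish. The resulting
  square matrix is surjective: \<open>K\<close> is, and adding a multiple of \<open>g\<close> adjusts entry \<open>k\<close> at will
  without changing the image under \<open>K\<close>. It is therefore injective. It annihilates the vector
  obtained from \<open>v\<close> by subtracting the multiple of \<open>g\<close> with the same entry \<open>k\<close>, so this vector
  is zero.
\<close>

lemma kernel_full_row_rank:
  fixes K :: "'a :: field mat"
  assumes K: "K \<in> carrier_mat m (Suc m)" and rank: "vec_space.rank m K = m"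
    and g: "g \<in> carrier_vec (Suc m)" and Kg: "K *\<^sub>v g = 0\<^sub>v m" and k: "k < Suc m" "g $ k \<noteq> 0"
    and v: "v \<in> carrier_vec (Suc m)" and Kv: "K *\<^sub>v v = 0\<^sub>v m"
  shows "v = (v $ k / g $ k) \<cdot>\<^sub>v g"
proof -
  define E where "E = mat_of_row (unit_vec (Suc m) k :: 'a vec)"
  define S where "S = K @\<^sub>r E"
  have E: "E \<in> carrier_mat 1 (Suc m)"
    unfolding E_def by (auto simp: mat_of_row_def)
  have S: "S \<in> carrier_mat (Suc m) (Suc m)"
    using carrier_append_rows[OF K E] unfolding S_def by simp
  have Ev: "E *\<^sub>v p = vec 1 (\<lambda>_. p $ k)" if "p \<in> carrier_vec (Suc m)" for p
    using that k by (intro eq_vecI) (auto simp: E_def)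
  have Sp: "S *\<^sub>v p = (K *\<^sub>v p) @\<^sub>v vec 1 (\<lambda>_. p $ k)" if "p \<in> carrier_vec (Suc m)" for p
    using mat_mult_append[OF K E that] Ev[OF that] by (simp add: S_def)
  have K_shift: "K *\<^sub>v (p + c \<cdot>\<^sub>v g) = K *\<^sub>v p" if "p \<in> carrier_vec (Suc m)" for p c
  proof -
    have "c \<cdot>\<^sub>v 0\<^sub>v m = 0\<^sub>v m"
      by (intro eq_vecI) auto
    then show ?thesis
      using mult_add_distrib_mat_vec[OF K that, of "c \<cdot>\<^sub>v g"] mult_mat_vec[OF K g, of c] g K that
      by (simp add: Kg)
  qed
  have surj: "\<exists>q \<in> carrier_vec (Suc m). S *\<^sub>v q = u" if u: "u \<in> carrier_vec (Suc m)" for u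
  proof -
    obtain p where p: "p \<in> carrier_vec (Suc m)" "K *\<^sub>v p = vec_first u m"
      using full_row_rank_surjective[OF K rank, of "vec_first u m"] by auto
    define q where "q = p + ((u $ m - p $ k) / g $ k) \<cdot>\<^sub>v g"
    have q: "q \<in> carrier_vec (Suc m)"
      using p g by (simp add: q_def)
    have qk: "q $ k = u $ m"
      using p g k by (simp add: q_def)
    have "S *\<^sub>v q = vec_first u m @\<^sub>v vec 1 (\<lambda>_. u $ m)"
      unfolding Sp[OF q] qk using K_shift[OF p(1)] p(2) by (simp add: q_def)
    also have "\<dots> = u"
      using u by (intro eq_vecI) (auto simp: vec_first_def less_Suc_eq)
    finally show ?thesis using q by blast
  qed
  define w where "w = v + (- (v $ k / g $ k)) \<cdot>\<^sub>v g"
  have w: "w \<in> carrier_vec (Suc m)"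
    using v g by (simp add: w_def)
  have wk: "w $ k = 0"
    using v g k by (simp add: w_def)
  have "S *\<^sub>v w = 0\<^sub>v (Suc m)"
    unfolding Sp[OF w] wk using K_shift[OF v] Kv by (intro eq_vecI) (auto simp: w_def)
  then have w0: "w = 0\<^sub>v (Suc m)"
    by (rule surjective_square_mat_injective[OF S _ w, rotated]) (rule surj)
  have "v $ i = (v $ k / g $ k) * g $ i" if "i < Suc m" for i
    using arg_cong[OF w0, of "\<lambda>x. x $ i"] that v g by (simp add: w_def)
  then show ?thesis
    using v g by (intro eq_vecI) auto
qed

section \<open>Kronecker products by blocks\<close>

lemma sum_div_mod:
  fixes h :: "nat \<Rightarrow> nat \<Rightarrow> 'a :: comm_monoid_add"
  shows "(\<Sum>c<d * n. h (c div n) (c mod n)) = (\<Sum>j<d. \<Sum>s<n. h j s)"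
proof -
  have "(\<Sum>c<d * n. h (c div n) (c mod n)) = (\<Sum>j<d. \<Sum>c = j * n..<j * n + n. h (c div n) (c mod n))"
    by (rule sum.nat_group[symmetric])
  also have "\<dots> = (\<Sum>j<d. \<Sum>s<n. h j s)"
  proof (rule sum.cong[OF refl])
    fix j
    have "(\<Sum>c = j * n..<j * n + n. h (c div n) (c mod n))
        = (\<Sum>s<n. h ((s + j * n) div n) ((s + j * n) mod n))"
      using sum.shift_bounds_nat_ivl[of "\<lambda>c. h (c div n) (c mod n)" 0 "j * n" n]
      by (simp add: add.commute atLeast0LessThan)
    also have "\<dots> = (\<Sum>s<n. h j s)"
      by (rule sum.cong) auto
    finally show "(\<Sum>c = j * n..<j * n + n. h (c div n) (c mod n)) = (\<Sum>s<n. h j s)" .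
  qed
  finally show ?thesis .
qed

lemma block_index_less:
  fixes j s d n :: nat
  assumes "j < d" "s < n"
  shows "j * n + s < d * n"
proof -
  have "j * n + s < Suc j * n" using assms by simp
  also have "\<dots> \<le> d * n" using assms by (intro mult_le_mono1) simp
  finally show ?thesis .
qed

lemma kron_vec_index:
  assumes "j < dim_vec u" "s < dim_vec v"
  shows "kron_vec u v $ (j * dim_vec v + s) = u $ j * v $ s"
  using assms block_index_less[OF assms] by (simp add: kron_vec_def)

text \<open>
  If \<open>y\<close> is read as the \<open>d \<times> n\<close> matrix stored row by row, this is its column \<open>s\<close>; equivalently, it
  collects entry \<open>s\<close> of each of the \<open>d\<close> consecutive blocks of length \<open>n\<close>.
\<close>

definition strided_vec :: "nat \<Rightarrow> nat \<Rightarrow> 'a vec \<Rightarrow> nat \<Rightarrow> 'a vec" where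
  "strided_vec d n y s = vec d (\<lambda>j. y $ (j * n + s))"

lemma strided_vec_carrier [simp]: "strided_vec d n y s \<in> carrier_vec d"
  by (simp add: strided_vec_def)

lemma strided_kron_vec:
  fixes u v :: "'a :: comm_semiring_1 vec"
  assumes "u \<in> carrier_vec d" "v \<in> carrier_vec n" "s < n"
  shows "strided_vec d n (kron_vec u v) s = v $ s \<cdot>\<^sub>v u"
  using assms kron_vec_index[of _ u s v]
  by (intro eq_vecI) (auto simp: strided_vec_def mult.commute)

text \<open>
  The factor \<open>I\<close> only couples entries at the same position \<open>s\<close> of their blocks, so the Kronecker
  product decouples into \<open>n\<close> independent copies of \<open>K\<close>.
\<close>

lemma kron_one_mult_vec_index:
  fixes K :: "'a :: comm_semiring_1 mat"
  assumes K: "K \<in> carrier_mat m d" and y: "y \<in> carrier_vec (d * n)" and "i < m" "s < n"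
  shows "(kron_mat K (1\<^sub>m n) *\<^sub>v y) $ (i * n + s) = (K *\<^sub>v strided_vec d n y s) $ i"
proof -
  have "(kron_mat K (1\<^sub>m n) *\<^sub>v y) $ (i * n + s)
      = (\<Sum>c<d * n. K $$ (i, c div n) * (1\<^sub>m n) $$ (s, c mod n) * y $ c)"
    using assms block_index_less[of i m s n]
    by (auto simp: kron_mat_def scalar_prod_def atLeast0LessThan)
  also have "\<dots> = (\<Sum>c<d * n. K $$ (i, c div n) * (1\<^sub>m n) $$ (s, c mod n) * y $ (c div n * n + c mod n))"
    by simp
  also have "\<dots> = (\<Sum>j<d. \<Sum>t<n. K $$ (i, j) * (1\<^sub>m n) $$ (s, t) * y $ (j * n + t))"
    by (rule sum_div_mod)
  also have "\<dots> = (\<Sum>j<d. \<Sum>t<n. if t = s then K $$ (i, j) * y $ (j * n + t) else 0)"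
    using \<open>s < n\<close> by (intro sum.cong) auto
  also have "\<dots> = (\<Sum>j<d. K $$ (i, j) * y $ (j * n + s))"
    using \<open>s < n\<close> by simp
  also have "\<dots> = (K *\<^sub>v strided_vec d n y s) $ i"
    using assms by (auto simp: strided_vec_def scalar_prod_def atLeast0LessThan)
  finally show ?thesis .
qed

lemma kron_one_mult_vec_eq_0_iff:
  fixes K :: "'a :: comm_semiring_1 mat"
  assumes K: "K \<in> carrier_mat m d" and y: "y \<in> carrier_vec (d * n)"
  shows "kron_mat K (1\<^sub>m n) *\<^sub>v y = 0\<^sub>v (m * n) \<longleftrightarrow>
    (\<forall>s<n. K *\<^sub>v strided_vec d n y s = 0\<^sub>v m)" (is "?L \<longleftrightarrow> ?R")
proof
  assume L: ?L
  show ?R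
  proof (intro allI impI eq_vecI)
    fix s i assume "s < n" "i < dim_vec (0\<^sub>v m :: 'a vec)"
    then show "(K *\<^sub>v strided_vec d n y s) $ i = 0\<^sub>v m $ i"
      using kron_one_mult_vec_index[OF K y, of i s] L block_index_less[of i m s n] by simp
  qed (use K in auto)
next
  assume R: ?R
  show ?L
  proof (rule eq_vecI)
    fix r assume r: "r < dim_vec (0\<^sub>v (m * n) :: 'a vec)"
    then have "0 < n" by (cases n) auto
    then have "r div n < m" "r mod n < n"
      using r by (auto simp: less_mult_imp_div_less)
    then show "(kron_mat K (1\<^sub>m n) *\<^sub>v y) $ r = 0\<^sub>v (m * n) $ r"
      using kron_one_mult_vec_index[OF K y, of "r div n" "r mod n"] R r by simp
  qed (use K in \<open>auto simp: kron_mat_def\<close>)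
qed

text \<open>
  In the forward direction each strided vector is a multiple of \<open>g\<close>, and these multiples are the
  entries of \<open>z\<close>. They are read off at a position \<open>k\<close> with \<open>g $ k \<noteq> 0\<close>.
\<close>

lemma kron_one_kernel_iff:
  fixes K :: "'a :: field mat"
  assumes K: "K \<in> carrier_mat m (Suc m)" and rank: "vec_space.rank m K = m"
    and g: "g \<in> carrier_vec (Suc m)" "g \<noteq> 0\<^sub>v (Suc m)" and Kg: "K *\<^sub>v g = 0\<^sub>v m"
    and y: "y \<in> carrier_vec (Suc m * n)"
  shows "kron_mat K (1\<^sub>m n) *\<^sub>v y = 0\<^sub>v (m * n) \<longleftrightarrow> (\<exists>z \<in> carrier_vec n. y = kron_vec g z)"
    (is "?L \<longleftrightarrow> ?R")
proof
  assume ?L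
  then have ker: "K *\<^sub>v strided_vec (Suc m) n y s = 0\<^sub>v m" if "s < n" for s
    using kron_one_mult_vec_eq_0_iff[OF K y] that by blast
  obtain k where k: "k < Suc m" "g $ k \<noteq> 0"
    using g by (metis carrier_vecD eq_vecI index_zero_vec(1) index_zero_vec(2))
  define z where "z = vec n (\<lambda>s. y $ (k * n + s) / g $ k)"
  have entry: "y $ (j * n + s) = g $ j * z $ s" if "j < Suc m" "s < n" for j s
  proof -
    have "strided_vec (Suc m) n y s $ j =
        ((strided_vec (Suc m) n y s $ k / g $ k) \<cdot>\<^sub>v g) $ j"
      using kernel_full_row_rank[OF K rank g(1) Kg k strided_vec_carrier ker[OF \<open>s < n\<close>]] by simp
    then show ?thesis
      using that k g by (simp add: strided_vec_def z_def)
  qed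
  have "y = kron_vec g z"
  proof (rule eq_vecI)
    fix r assume "r < dim_vec (kron_vec g z)"
    then have r: "r < Suc m * n" using g by (simp add: kron_vec_def z_def)
    then have "0 < n" by (cases n) auto
    then have "r div n < Suc m" "r mod n < n"
      using r by (auto simp: less_mult_imp_div_less)
    then show "y $ r = kron_vec g z $ r"
      using entry[of "r div n" "r mod n"] kron_vec_index[of "r div n" g "r mod n" z] g
      by (simp add: z_def)
  qed (use y g in \<open>simp add: kron_vec_def z_def\<close>)
  then show ?R by (intro bexI[of _ z]) (simp_all add: z_def)
next
  assume ?R
  then obtain z where z: "z \<in> carrier_vec n" and y_eq: "y = kron_vec g z" by blast
  have "K *\<^sub>v strided_vec (Suc m) n y s = 0\<^sub>v m" if "s < n" for s
    unfolding y_eq strided_kron_vec[OF g(1) z that] mult_mat_vec[OF K g(1)] Kg by (intro eq_vecI) auto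
  then show ?L
    using kron_one_mult_vec_eq_0_iff[OF K y] by blast
qed

lemma kron_vec_right_cancel:
  fixes g :: "'a :: field vec"
  assumes g: "g \<noteq> 0\<^sub>v (dim_vec g)" and z: "z \<in> carrier_vec n" "z' \<in> carrier_vec n"
    and eq: "kron_vec g z = kron_vec g z'"
  shows "z = z'"
proof -
  obtain k where k: "k < dim_vec g" "g $ k \<noteq> 0"
    using g by (metis eq_vecI index_zero_vec(1) index_zero_vec(2))
  show ?thesis
  proof (rule eq_vecI)
    fix s assume "s < dim_vec z'"
    then show "z $ s = z' $ s"
      using kron_vec_index[of k g s z] kron_vec_index[of k g s z'] k z eq by simp
  qed (use z in simp)
qed

section \<open>The linearization\<close>

lemma block_row_mult_kron_vec:
  fixes C :: "nat \<Rightarrow> 'a :: comm_semiring_1 mat"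
  assumes g: "g \<in> carrier_vec d" and z: "z \<in> carrier_vec n"
  shows "block_row n d C *\<^sub>v kron_vec g z =
    mat n n (\<lambda>(r, s). \<Sum>j<d. g $ j * C (Suc j) $$ (r, s)) *\<^sub>v z"
proof (rule eq_vecI)
  fix r assume "r < dim_vec (mat n n (\<lambda>(r, s). \<Sum>j<d. g $ j * C (Suc j) $$ (r, s)) *\<^sub>v z)"
  then have r: "r < n" by simp
  have "(block_row n d C *\<^sub>v kron_vec g z) $ r =
      (\<Sum>c<d * n. C (Suc (c div n)) $$ (r, c mod n) * (g $ (c div n) * z $ (c mod n)))"
    using r g z by (auto simp: block_row_def kron_vec_def scalar_prod_def atLeast0LessThan)
  also have "\<dots> = (\<Sum>j<d. \<Sum>s<n. C (Suc j) $$ (r, s) * (g $ j * z $ s))"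
    by (rule sum_div_mod)
  also have "\<dots> = (\<Sum>s<n. \<Sum>j<d. C (Suc j) $$ (r, s) * (g $ j * z $ s))"
    by (rule sum.swap)
  also have "\<dots> = (mat n n (\<lambda>(r, s). \<Sum>j<d. g $ j * C (Suc j) $$ (r, s)) *\<^sub>v z) $ r"
    using r z by (auto simp: scalar_prod_def atLeast0LessThan sum_distrib_left sum_distrib_right
        mult_ac intro!: sum.cong)
  finally show "(block_row n d C *\<^sub>v kron_vec g z) $ r =
    (mat n n (\<lambda>(r, s). \<Sum>j<d. g $ j * C (Suc j) $$ (r, s)) *\<^sub>v z) $ r" .
qed (simp add: block_row_def)

text \<open>
  The coefficients \<open>f\<^sub>i(\<mu>)\<close> of \<open>P(\<mu>)\<close> can be moved from the matrices to the vector. The proof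
  also shifts the index range from \<open>1, \<dots>, d\<close> to the positions \<open>0, \<dots>, d - 1\<close> of \<open>f(\<mu>)\<close>.
\<close>

lemma nonlinear_mat_mult_vec:
  assumes A: "\<And>i. i \<in> {1..d} \<Longrightarrow> A i \<in> carrier_mat n n"
    and B: "\<And>i. i \<in> {1..d} \<Longrightarrow> B i \<in> carrier_mat n n"
    and z: "z \<in> carrier_vec n"
  shows "nonlinear_mat n d A B f \<mu> *\<^sub>v z =
    block_row n d (\<lambda>i. A i - \<mu> \<cdot>\<^sub>m B i) *\<^sub>v kron_vec (fun_vec d f \<mu>) z"
proof -
  have "nonlinear_mat n d A B f \<mu> = mat n n (\<lambda>(r, s).
      \<Sum>j<d. fun_vec d f \<mu> $ j * (A (Suc j) - \<mu> \<cdot>\<^sub>m B (Suc j)) $$ (r, s))"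
  proof (rule eq_matI)
    fix r s assume rs: "r < dim_row (mat n n (\<lambda>(r, s).
      \<Sum>j<d. fun_vec d f \<mu> $ j * (A (Suc j) - \<mu> \<cdot>\<^sub>m B (Suc j)) $$ (r, s)))"
      "s < dim_col (mat n n (\<lambda>(r, s).
      \<Sum>j<d. fun_vec d f \<mu> $ j * (A (Suc j) - \<mu> \<cdot>\<^sub>m B (Suc j)) $$ (r, s)))"
    have dims: "dim_row (B (Suc j)) = n" "dim_col (B (Suc j)) = n" if "j < d" for j
      using B[of "Suc j"] that by auto
    have "(\<Sum>i = 1..d. (f i \<mu> \<cdot>\<^sub>m (A i - \<mu> \<cdot>\<^sub>m B i)) $$ (r, s)) =
        (\<Sum>j<d. (f (Suc j) \<mu> \<cdot>\<^sub>m (A (Suc j) - \<mu> \<cdot>\<^sub>m B (Suc j))) $$ (r, s))"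
      unfolding One_nat_def by (rule sum.atLeast1_atMost_eq)
    also have "\<dots> = (\<Sum>j<d. fun_vec d f \<mu> $ j * (A (Suc j) - \<mu> \<cdot>\<^sub>m B (Suc j)) $$ (r, s))"
      using rs by (intro sum.cong) (auto simp: fun_vec_def dims)
    finally show "nonlinear_mat n d A B f \<mu> $$ (r, s) = mat n n (\<lambda>(r, s).
      \<Sum>j<d. fun_vec d f \<mu> $ j * (A (Suc j) - \<mu> \<cdot>\<^sub>m B (Suc j)) $$ (r, s)) $$ (r, s)"
      using rs by (simp add: nonlinear_mat_def)
  qed (simp_all add: nonlinear_mat_def)
  then show ?thesis
    using block_row_mult_kron_vec[of "fun_vec d f \<mu>" d z n] z by (simp add: fun_vec_def)
qed

lemma linearization_pencil:
  assumes A: "\<And>i. i \<in> {1..d} \<Longrightarrow> A i \<in> carrier_mat n n"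
    and B: "\<And>i. i \<in> {1..d} \<Longrightarrow> B i \<in> carrier_mat n n"
    and M: "M \<in> carrier_mat m d" and N: "N \<in> carrier_mat m d"
  shows "linearization n d A M - \<mu> \<cdot>\<^sub>m linearization n d B N =
    linearization n d (\<lambda>i. A i - \<mu> \<cdot>\<^sub>m B i) (M - \<mu> \<cdot>\<^sub>m N)" (is "?L = ?R")
proof (rule eq_matI)
  fix r c assume "r < dim_row ?R" "c < dim_col ?R"
  then have r: "r < n + m * n" and c: "c < d * n"
    using M N by (auto simp: linearization_def append_rows_def block_row_def kron_mat_def)
  have n: "0 < n" using c by (cases n) auto
  have "c div n < d" "c mod n < n"
    using c n by (auto simp: less_mult_imp_div_less)
  moreover from this have "B (Suc (c div n)) \<in> carrier_mat n n"
    by (intro B) auto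
  moreover have "(r - n) div n < m" "(r - n) mod n < n" if "\<not> r < n"
    using r that n by (auto simp: less_mult_imp_div_less)
  ultimately show "?L $$ (r, c) = ?R $$ (r, c)"
    using r c M N
    by (auto simp: linearization_def append_rows_def block_row_def kron_mat_def algebra_simps)
qed (use M N in \<open>auto simp: linearization_def append_rows_def block_row_def kron_mat_def\<close>)

lemma kron_unit_vec_0:
  fixes b :: "'a :: comm_semiring_1 vec"
  assumes b: "b \<in> carrier_vec n"
  shows "kron_vec (unit_vec (Suc m) 0) b = b @\<^sub>v 0\<^sub>v (m * n)"
proof (rule eq_vecI)
  fix r assume "r < dim_vec (b @\<^sub>v (0\<^sub>v (m * n) :: 'a vec))"
  then have r: "r < n + m * n" using b by simp
  then have n: "0 < n" by (cases n) auto
  have "r div n < Suc m"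
    using r by (auto simp: less_mult_imp_div_less)
  moreover have "r div n = 0 \<longleftrightarrow> r < n"
    using n by (simp add: div_eq_0_iff)
  ultimately show "kron_vec (unit_vec (Suc m) 0) b $ r = (b @\<^sub>v 0\<^sub>v (m * n)) $ r"
    using r b by (auto simp: kron_vec_def)
qed (use b in \<open>simp add: kron_vec_def\<close>)

text \<open>
  The lower block of the system forces the Kronecker form of \<open>y\<close>; what remains of the system is
  its upper block, evaluated on vectors of that form.
\<close>

lemma linearization_solution_iff:
  fixes K :: "complex mat"
  assumes K: "K \<in> carrier_mat m (Suc m)" and rank: "vec_space.rank m K = m"
    and g: "g \<in> carrier_vec (Suc m)" "g \<noteq> 0\<^sub>v (Suc m)" and Kg: "K *\<^sub>v g = 0\<^sub>v m"
    and b: "b \<in> carrier_vec n" and y: "y \<in> carrier_vec (Suc m * n)"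
  shows "linearization n (Suc m) C K *\<^sub>v y = kron_vec (unit_vec (Suc m) 0) b \<longleftrightarrow>
    (\<exists>z \<in> carrier_vec n. y = kron_vec g z \<and> block_row n (Suc m) C *\<^sub>v kron_vec g z = b)"
proof -
  have C: "block_row n (Suc m) C \<in> carrier_mat n (Suc m * n)"
    by (simp add: block_row_def)
  have KI: "kron_mat K (1\<^sub>m n) \<in> carrier_mat (m * n) (Suc m * n)"
    using K by (auto simp: kron_mat_def)
  have "linearization n (Suc m) C K *\<^sub>v y =
      (block_row n (Suc m) C *\<^sub>v y) @\<^sub>v (kron_mat K (1\<^sub>m n) *\<^sub>v y)"
    unfolding linearization_def by (rule mat_mult_append[OF C KI y])
  then have "linearization n (Suc m) C K *\<^sub>v y = kron_vec (unit_vec (Suc m) 0) b \<longleftrightarrow>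
      block_row n (Suc m) C *\<^sub>v y = b \<and> kron_mat K (1\<^sub>m n) *\<^sub>v y = 0\<^sub>v (m * n)"
    using append_vec_eq[OF mult_mat_vec_carrier[OF C y] b] by (simp add: kron_unit_vec_0[OF b])
  then show ?thesis
    using kron_one_kernel_iff[OF K rank g Kg y] by auto
qed

theorem theorem3p1:
  fixes n d :: nat
    and A B :: "nat \<Rightarrow> complex mat"
    and f :: "nat \<Rightarrow> complex \<Rightarrow> complex"
    and M N :: "complex mat"
    and \<mu> :: complex
    and b x :: "complex vec"
  assumes "n \<ge> 1" and "d \<ge> 2"
    and "\<And>i. i \<in> {1..d} \<Longrightarrow> A i \<in> carrier_mat n n"
    and "\<And>i. i \<in> {1..d} \<Longrightarrow> B i \<in> carrier_mat n n"
    and "M \<in> carrier_mat (d - 1) d" and "N \<in> carrier_mat (d - 1) d"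
    and "(M - \<mu> \<cdot>\<^sub>m N) *\<^sub>v fun_vec d f \<mu> = 0\<^sub>v (d - 1)"
    and "vec_space.rank (d - 1) (M - \<mu> \<cdot>\<^sub>m N) = d - 1"
    and "fun_vec d f \<mu> \<noteq> 0\<^sub>v d"
    and "b \<in> carrier_vec n" and "x \<in> carrier_vec n"
  shows "is_unique_solution (nonlinear_mat n d A B f \<mu>) b x \<longleftrightarrow>
    is_unique_solution (linearization n d A M - \<mu> \<cdot>\<^sub>m linearization n d B N)
      (kron_vec (unit_vec d 0) b) (kron_vec (fun_vec d f \<mu>) x)"
proof -
  define m where "m = d - 1"
  have d: "d = Suc m" "d - 1 = m"
    using assms(2) by (auto simp: m_def)
  define g where "g = fun_vec d f \<mu>"
  define P where "P = nonlinear_mat n d A B f \<mu>"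
  define L where "L = linearization n d A M - \<mu> \<cdot>\<^sub>m linearization n d B N"
  have g: "g \<in> carrier_vec d" "g \<noteq> 0\<^sub>v d"
    using assms(9) by (auto simp: g_def fun_vec_def)
  have L_sol: "L *\<^sub>v y = kron_vec (unit_vec d 0) b \<longleftrightarrow>
      (\<exists>z \<in> carrier_vec n. y = kron_vec g z \<and> P *\<^sub>v z = b)" if "y \<in> carrier_vec (d * n)" for y
  proof -
    have K: "M - \<mu> \<cdot>\<^sub>m N \<in> carrier_mat m (Suc m)"
      using assms(5,6) by (auto simp: d)
    show ?thesis
      using linearization_solution_iff[OF K, of g b n y "\<lambda>i. A i - \<mu> \<cdot>\<^sub>m B i"] that assms(7,8,10) g
        linearization_pencil[OF assms(3,4,5,6)]
        nonlinear_mat_mult_vec[OF assms(3,4), where f = f and \<mu> = \<mu>]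
      by (auto simp: d L_def P_def g_def)
  qed
  have gz: "kron_vec g z \<in> carrier_vec (d * n)" if "z \<in> carrier_vec n" for z
    using that g by (auto simp: kron_vec_def)
  have cancel: "z = z'" if "kron_vec g z = kron_vec g z'" "z \<in> carrier_vec n" "z' \<in> carrier_vec n" for z z'
    using kron_vec_right_cancel[of g z n z'] that g by auto
  have dims: "dim_col P = n" "dim_col L = d * n"
    by (auto simp: P_def L_def nonlinear_mat_def linearization_def append_rows_def block_row_def)
  have "is_unique_solution P b x \<longleftrightarrow> is_unique_solution L (kron_vec (unit_vec d 0) b) (kron_vec g x)"
    unfolding is_unique_solution_def dims
    using L_sol gz cancel assms(11) by metis
  then show ?thesis
    by (simp add: P_def L_def g_def)
qed

end
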